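(* The assignments $L\mapsto L^\delta$ and $h\mapsto h^\delta$ constitute a functor from the category of locally compact frames and perfect frame homomorphisms to the category of completely distributive lattices and complete lattice homomorphisms.
   Context: The axiom of choice is assumed. A frame is a complete lattice in which finite meets distribute over arbitrary joins; frame homomorphisms preserve arbitrary joins and finite meets. For $a,c$ in a frame $L$, $c\ll a$ means: for every directed $D\subseteq L$, $a\le\bigvee D$ implies $c\le d$ for some $d\in D$. $L$ is locally compact if $a=\bigvee\{c\mid c\ll a\}$, a directed join, for every $a\in L$. A filter of $L$ is an upset closed under finite meets (the improper filter is allowed). A filter $\kappa\subseteq L$ is Scott-open if, whenever $D\subseteq L$ is directed and $\bigvee D\in\kappa$, then $d\in\kappa$ for some $d\in D$. $L^{\wedge}$ denotes the set of Scott-open filters of $L$, ordered by reverse inclusion. A canonical extension of a frame $L$ is a monotone map $e_L\colon L\to L^\delta$ into a complete lattice $L^\delta$ such that: (Dense) for all $u,v\in L^\delta$: $u\le v$ holds provided that for all $\kappa\in L^{\wedge}$ and $a\in L$, the inequalities $\bigwedge e_L[\kappa]\le u$ and $v\le e_L(a)$ together imply $\bigwedge e_L[\kappa]\le e_L(a)$; (Compact) if $\bigwedge e_L[\kappa]\le e_L(a)$ for some $\kappa\in L^{\wedge}$ and $a\in L$, then $a\in\kappa$. Every frame has a canonical extension, unique up to isomorphism; for each $L$ a canonical extension $e_L\colon L\to L^\delta$ is fixed. For a monotone map $f\colon L\to M$ between frames, define $f^\sigma,f^\pi\colon L^\delta\to M^\delta$ by $f^\sigma(u)=\bigvee\{\bigwedge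 e_M[f[\kappa]]\mid \kappa\in L^{\wedge},\ \bigwedge e_L[\kappa]\le u\}$ and $f^\pi(u)=\bigwedge\{e_M(f(a))\mid a\in L,\ u\le e_L(a)\}$. If $f$ preserves directed joins and finite meets (in particular if $f$ is a frame homomorphism), then $f^\sigma=f^\pi$, and this common map is denoted $f^\delta$. A monotone map $f\colon L\to M$ between frames is perfect if for every $\kappa\in L^{\wedge}$ the smallest filter of $M$ containing $f[\kappa]$ is Scott-open. A complete lattice homomorphism is a map preserving arbitrary joins and arbitrary meets. *)

theory Defs
  imports "HOL-Algebra.Complete_Lattice"
begin

section \<open>Categories and functors\<close>

text \<open>Hom-sets of distinct pairs of objects are not required to be disjoint, so composition and
  the arrow part of a functor take the objects as arguments.\<close>

record ('o, 'm) cat =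
  Ob :: "'o set"
  Hom :: "'o \<Rightarrow> 'o \<Rightarrow> 'm set"
  Idt :: "'o \<Rightarrow> 'm"
  Comp :: "'o \<Rightarrow> 'o \<Rightarrow> 'o \<Rightarrow> 'm \<Rightarrow> 'm \<Rightarrow> 'm"

locale category =
  fixes C :: "('o, 'm) cat"
  assumes Idt_closed: "A \<in> Ob C \<Longrightarrow> Idt C A \<in> Hom C A A"
    and Comp_closed:
      "\<lbrakk>A \<in> Ob C; B \<in> Ob C; D \<in> Ob C; f \<in> Hom C A B; g \<in> Hom C B D\<rbrakk>
        \<Longrightarrow> Comp C A B D g f \<in> Hom C A D"
    and Comp_Idt_left:
      "\<lbrakk>A \<in> Ob C; B \<in> Ob C; f \<in> Hom C A B\<rbrakk> \<Longrightarrow> Comp C A B B (Idt C B) f = f"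
    and Comp_Idt_right:
      "\<lbrakk>A \<in> Ob C; B \<in> Ob C; f \<in> Hom C A B\<rbrakk> \<Longrightarrow> Comp C A A B f (Idt C A) = f"
    and Comp_assoc:
      "\<lbrakk>A \<in> Ob C; B \<in> Ob C; D \<in> Ob C; E \<in> Ob C;
        f \<in> Hom C A B; g \<in> Hom C B D; h \<in> Hom C D E\<rbrakk>
        \<Longrightarrow> Comp C A D E h (Comp C A B D g f) = Comp C A B E (Comp C B D E h g) f"

locale covariant_functor = source: category C + target: category D
  for C :: "('o, 'm) cat" and D :: "('p, 'n) cat" +
  fixes F :: "'o \<Rightarrow> 'p" and Fm :: "'o \<Rightarrow> 'o \<Rightarrow> 'm \<Rightarrow> 'n"
  assumes functor_Ob: "A \<in> Ob C \<Longrightarrow> F A \<in> Ob D"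
    and functor_Hom:
      "\<lbrakk>A \<in> Ob C; B \<in> Ob C; f \<in> Hom C A B\<rbrakk> \<Longrightarrow> Fm A B f \<in> Hom D (F A) (F B)"
    and functor_Idt: "A \<in> Ob C \<Longrightarrow> Fm A A (Idt C A) = Idt D (F A)"
    and functor_Comp:
      "\<lbrakk>A \<in> Ob C; B \<in> Ob C; E \<in> Ob C; f \<in> Hom C A B; g \<in> Hom C B E\<rbrakk>
        \<Longrightarrow> Fm A E (Comp C A B E g f) = Comp D (F A) (F B) (F E) (Fm B E g) (Fm A B f)"

section \<open>Frames and Scott-open filters\<close>

locale frame = complete_lattice +
  assumes meet_sup_distrib:
    "\<lbrakk>x \<in> carrier L; A \<subseteq> carrier L\<rbrakk> \<Longrightarrow> x \<sqinter> (\<Squnion>A) = \<Squnion>((\<lambda>a. x \<sqinter> a) ` A)"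

definition directed_in :: "'a gorder \<Rightarrow> 'a set \<Rightarrow> bool" where
  "directed_in L D \<longleftrightarrow> D \<subseteq> carrier L \<and> D \<noteq> {} \<and>
     (\<forall>x\<in>D. \<forall>y\<in>D. \<exists>z\<in>D. x \<sqsubseteq>\<^bsub>L\<^esub> z \<and> y \<sqsubseteq>\<^bsub>L\<^esub> z)"

definition way_below :: "'a gorder \<Rightarrow> 'a \<Rightarrow> 'a \<Rightarrow> bool" where
  "way_below L c a \<longleftrightarrow>
     (\<forall>D. directed_in L D \<longrightarrow> a \<sqsubseteq>\<^bsub>L\<^esub> \<Squnion>\<^bsub>L\<^esub>D \<longrightarrow> (\<exists>d\<in>D. c \<sqsubseteq>\<^bsub>L\<^esub> d))"

definition locally_compact :: "'a gorder \<Rightarrow> bool" where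
  "locally_compact L \<longleftrightarrow>
     (\<forall>a\<in>carrier L. directed_in L {c \<in> carrier L. way_below L c a} \<and>
        a = \<Squnion>\<^bsub>L\<^esub>{c \<in> carrier L. way_below L c a})"

text \<open>Closure under the empty meet makes filters non-empty; the improper filter is allowed.\<close>

definition is_filter :: "'a gorder \<Rightarrow> 'a set \<Rightarrow> bool" where
  "is_filter L K \<longleftrightarrow> K \<subseteq> carrier L \<and>
     (\<forall>x\<in>K. \<forall>y\<in>carrier L. x \<sqsubseteq>\<^bsub>L\<^esub> y \<longrightarrow> y \<in> K) \<and>
     \<top>\<^bsub>L\<^esub> \<in> K \<and> (\<forall>x\<in>K. \<forall>y\<in>K. x \<sqinter>\<^bsub>L\<^esub> y \<in> K)"

definition generated_filter :: "'a gorder \<Rightarrow> 'a set \<Rightarrow> 'a set" where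
  "generated_filter L S = \<Inter>{K. is_filter L K \<and> S \<subseteq> K}"

definition scott_open :: "'a gorder \<Rightarrow> 'a set \<Rightarrow> bool" where
  "scott_open L K \<longleftrightarrow>
     (\<forall>D. directed_in L D \<longrightarrow> \<Squnion>\<^bsub>L\<^esub>D \<in> K \<longrightarrow> (\<exists>d\<in>D. d \<in> K))"

definition scott_open_filters :: "'a gorder \<Rightarrow> 'a set set" where
  "scott_open_filters L = {K. is_filter L K \<and> scott_open L K}"

section \<open>Morphisms\<close>

definition finite_meet_pres :: "'a gorder \<Rightarrow> 'b gorder \<Rightarrow> ('a \<Rightarrow> 'b) \<Rightarrow> bool" where
  "finite_meet_pres L M f \<longleftrightarrow> meet_pres L M f \<and> f \<top>\<^bsub>L\<^esub> = \<top>\<^bsub>M\<^esub>"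

definition directed_sup_pres :: "'a gorder \<Rightarrow> 'b gorder \<Rightarrow> ('a \<Rightarrow> 'b) \<Rightarrow> bool" where
  "directed_sup_pres L M f \<longleftrightarrow>
     (\<forall>D. directed_in L D \<longrightarrow> f (\<Squnion>\<^bsub>L\<^esub>D) = \<Squnion>\<^bsub>M\<^esub>(f ` D))"

definition frame_hom :: "'a gorder \<Rightarrow> 'b gorder \<Rightarrow> ('a \<Rightarrow> 'b) \<Rightarrow> bool" where
  "frame_hom L M f \<longleftrightarrow>
     f \<in> carrier L \<rightarrow> carrier M \<and> sup_pres L M f \<and> finite_meet_pres L M f"

definition perfect_map :: "'a gorder \<Rightarrow> 'b gorder \<Rightarrow> ('a \<Rightarrow> 'b) \<Rightarrow> bool" where
  "perfect_map L M f \<longleftrightarrow> f \<in> carrier L \<rightarrow> carrier M \<and> isotone L M f \<and>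
     (\<forall>K\<in>scott_open_filters L. scott_open M (generated_filter M (f ` K)))"

definition complete_lattice_hom :: "'a gorder \<Rightarrow> 'b gorder \<Rightarrow> ('a \<Rightarrow> 'b) \<Rightarrow> bool" where
  "complete_lattice_hom L M f \<longleftrightarrow>
     f \<in> carrier L \<rightarrow> carrier M \<and> sup_pres L M f \<and> inf_pres L M f"

text \<open>As in the type class \<^class>\<open>complete_distrib_lattice\<close>, families of families are given
  as sets of sets; \<open>\<Pi>\<^sub>E\<close> ranges over their choice functions.\<close>

locale completely_distributive_lattice = complete_lattice +
  assumes complete_distrib:
    "\<S> \<subseteq> Pow (carrier L) \<Longrightarrow>
       \<Sqinter>((\<lambda>S. \<Squnion>S) ` \<S>) = \<Squnion>((\<lambda>c. \<Sqinter>(c ` \<S>)) ` (\<Pi>\<^sub>E S\<in>\<S>. S))"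

section \<open>Canonical extensions\<close>

definition canonical_extension :: "'a gorder \<Rightarrow> 'b gorder \<Rightarrow> ('a \<Rightarrow> 'b) \<Rightarrow> bool" where
  "canonical_extension L X e \<longleftrightarrow>
     complete_lattice X \<and> e \<in> carrier L \<rightarrow> carrier X \<and> isotone L X e \<and>
     (\<forall>u\<in>carrier X. \<forall>v\<in>carrier X.
        (\<forall>K\<in>scott_open_filters L. \<forall>a\<in>carrier L.
           \<Sqinter>\<^bsub>X\<^esub>(e ` K) \<sqsubseteq>\<^bsub>X\<^esub> u \<and> v \<sqsubseteq>\<^bsub>X\<^esub> e a \<longrightarrow> \<Sqinter>\<^bsub>X\<^esub>(e ` K) \<sqsubseteq>\<^bsub>X\<^esub> e a)
        \<longrightarrow> u \<sqsubseteq>\<^bsub>X\<^esub> v) \<and>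
     (\<forall>K\<in>scott_open_filters L. \<forall>a\<in>carrier L. \<Sqinter>\<^bsub>X\<^esub>(e ` K) \<sqsubseteq>\<^bsub>X\<^esub> e a \<longrightarrow> a \<in> K)"

text \<open>In the extensions of \<open>f : L \<rightarrow> M\<close>, the pairs \<open>X\<close>, \<open>e\<close> and \<open>Y\<close>, \<open>e'\<close> are the chosen
  canonical extensions of \<open>L\<close> and \<open>M\<close>.  Values outside \<open>carrier X\<close> are \<^const>\<open>undefined\<close>.\<close>

definition sigma_ext ::
  "'a gorder \<Rightarrow> 'b gorder \<Rightarrow> ('a \<Rightarrow> 'b) \<Rightarrow> 'd gorder \<Rightarrow> ('c \<Rightarrow> 'd) \<Rightarrow> ('a \<Rightarrow> 'c) \<Rightarrow> 'b \<Rightarrow> 'd" where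
  "sigma_ext L X e Y e' f = (\<lambda>u\<in>carrier X.
     \<Squnion>\<^bsub>Y\<^esub>{\<Sqinter>\<^bsub>Y\<^esub>(e' ` f ` K) | K. K \<in> scott_open_filters L \<and> \<Sqinter>\<^bsub>X\<^esub>(e ` K) \<sqsubseteq>\<^bsub>X\<^esub> u})"

definition pi_ext ::
  "'a gorder \<Rightarrow> 'b gorder \<Rightarrow> ('a \<Rightarrow> 'b) \<Rightarrow> 'd gorder \<Rightarrow> ('c \<Rightarrow> 'd) \<Rightarrow> ('a \<Rightarrow> 'c) \<Rightarrow> 'b \<Rightarrow> 'd" where
  "pi_ext L X e Y e' f = (\<lambda>u\<in>carrier X.
     \<Sqinter>\<^bsub>Y\<^esub>{e' (f a) | a. a \<in> carrier L \<and> u \<sqsubseteq>\<^bsub>X\<^esub> e a})"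

text \<open>Used for maps whose two extensions agree, see \<open>sigma_ext_eq_pi_ext\<close> below.\<close>

definition delta_ext ::
  "'a gorder \<Rightarrow> 'b gorder \<Rightarrow> ('a \<Rightarrow> 'b) \<Rightarrow> 'd gorder \<Rightarrow> ('c \<Rightarrow> 'd) \<Rightarrow> ('a \<Rightarrow> 'c) \<Rightarrow> 'b \<Rightarrow> 'd" where
  "delta_ext L X e Y e' f = sigma_ext L X e Y e' f"

section \<open>The two categories\<close>

text \<open>The carriers of the objects are subsets of an arbitrary type.  Arrows are extensional
  functions, so that they are equal when they agree on the domain.\<close>

definition lc_frame_cat :: "('a gorder, 'a \<Rightarrow> 'a) cat" where
  "lc_frame_cat =
     \<lparr>Ob = {L. frame L \<and> locally_compact L},
      Hom = (\<lambda>L M. {f \<in> extensional (carrier L). frame_hom L M f \<and> perfect_map L M f}),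
      Idt = (\<lambda>L. \<lambda>x\<in>carrier L. x),
      Comp = (\<lambda>L M N g f. compose (carrier L) g f)\<rparr>"

definition cd_lattice_cat :: "('b gorder, 'b \<Rightarrow> 'b) cat" where
  "cd_lattice_cat =
     \<lparr>Ob = {X. completely_distributive_lattice X},
      Hom = (\<lambda>X Y. {f \<in> extensional (carrier X). complete_lattice_hom X Y f}),
      Idt = (\<lambda>X. \<lambda>x\<in>carrier X. x),
      Comp = (\<lambda>X Y Z g f. compose (carrier X) g f)\<rparr>"

section \<open>The two extensions of a map agree\<close>

lemma complete_lattice_inf:
  assumes "complete_lattice X" "A \<subseteq> carrier X"
  shows "\<Sqinter>\<^bsub>X\<^esub>A \<in> carrier X"
    and "a \<in> A \<Longrightarrow> \<Sqinter>\<^bsub>X\<^esub>A \<sqsubseteq>\<^bsub>X\<^esub> a"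
    and "\<lbrakk>z \<in> carrier X; \<And>a. a \<in> A \<Longrightarrow> z \<sqsubseteq>\<^bsub>X\<^esub> a\<rbrakk> \<Longrightarrow> z \<sqsubseteq>\<^bsub>X\<^esub> \<Sqinter>\<^bsub>X\<^esub>A"
proof -
  interpret complete_lattice X by fact
  show "\<Sqinter>\<^bsub>X\<^esub>A \<in> carrier X" using assms(2) by simp
  show "a \<in> A \<Longrightarrow> \<Sqinter>\<^bsub>X\<^esub>A \<sqsubseteq>\<^bsub>X\<^esub> a" using assms(2) by (simp add: inf_lower)
  show "\<lbrakk>z \<in> carrier X; \<And>a. a \<in> A \<Longrightarrow> z \<sqsubseteq>\<^bsub>X\<^esub> a\<rbrakk> \<Longrightarrow> z \<sqsubseteq>\<^bsub>X\<^esub> \<Sqinter>\<^bsub>X\<^esub>A"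
    using assms(2) by (simp add: inf_greatest)
qed

lemma complete_lattice_sup:
  assumes "complete_lattice X" "A \<subseteq> carrier X"
  shows "\<Squnion>\<^bsub>X\<^esub>A \<in> carrier X"
    and "a \<in> A \<Longrightarrow> a \<sqsubseteq>\<^bsub>X\<^esub> \<Squnion>\<^bsub>X\<^esub>A"
    and "\<lbrakk>z \<in> carrier X; \<And>a. a \<in> A \<Longrightarrow> a \<sqsubseteq>\<^bsub>X\<^esub> z\<rbrakk> \<Longrightarrow> \<Squnion>\<^bsub>X\<^esub>A \<sqsubseteq>\<^bsub>X\<^esub> z"
proof -
  interpret complete_lattice X by fact
  show "\<Squnion>\<^bsub>X\<^esub>A \<in> carrier X" using assms(2) by simp
  show "a \<in> A \<Longrightarrow> a \<sqsubseteq>\<^bsub>X\<^esub> \<Squnion>\<^bsub>X\<^esub>A" using assms(2) by (simp add: sup_upper)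
  show "\<lbrakk>z \<in> carrier X; \<And>a. a \<in> A \<Longrightarrow> a \<sqsubseteq>\<^bsub>X\<^esub> z\<rbrakk> \<Longrightarrow> \<Squnion>\<^bsub>X\<^esub>A \<sqsubseteq>\<^bsub>X\<^esub> z"
    using assms(2) by (simp add: sup_least)
qed

lemma canonical_extension_dense:
  assumes "canonical_extension L X e" "u \<in> carrier X" "v \<in> carrier X"
    and "\<And>K a. \<lbrakk>K \<in> scott_open_filters L; a \<in> carrier L;
          \<Sqinter>\<^bsub>X\<^esub>(e ` K) \<sqsubseteq>\<^bsub>X\<^esub> u; v \<sqsubseteq>\<^bsub>X\<^esub> e a\<rbrakk> \<Longrightarrow> \<Sqinter>\<^bsub>X\<^esub>(e ` K) \<sqsubseteq>\<^bsub>X\<^esub> e a"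
  shows "u \<sqsubseteq>\<^bsub>X\<^esub> v"
  using assms unfolding canonical_extension_def by simp

lemma scott_open_filter_vimage:
  assumes L: "frame L" and M: "frame M"
    and f: "f \<in> carrier L \<rightarrow> carrier M" "isotone L M f"
    and pres: "directed_sup_pres L M f" "finite_meet_pres L M f"
    and K: "K \<in> scott_open_filters M"
  shows "{a \<in> carrier L. f a \<in> K} \<in> scott_open_filters L"
proof -
  interpret L: frame L by fact
  have filt: "is_filter M K" and so: "scott_open M K"
    using K by (auto simp: scott_open_filters_def)
  have "is_filter L {a \<in> carrier L. f a \<in> K}"
    using filt f pres(2)
    by (auto simp: is_filter_def isotone_def finite_meet_pres_def meet_pres_def Pi_iff)
  moreover have "scott_open L {a \<in> carrier L. f a \<in> K}"
    unfolding scott_open_def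
  proof (intro allI impI)
    fix D assume D: "directed_in L D" and "\<Squnion>\<^bsub>L\<^esub>D \<in> {a \<in> carrier L. f a \<in> K}"
    then have "\<Squnion>\<^bsub>M\<^esub>(f ` D) \<in> K"
      using pres(1) by (simp add: directed_sup_pres_def)
    moreover have "directed_in M (f ` D)"
      using D f unfolding directed_in_def isotone_def
      by (auto simp: Pi_iff subset_iff) (metis subsetD)
    ultimately obtain d where "d \<in> D" "f d \<in> K"
      using so by (auto simp: scott_open_def)
    then show "\<exists>d\<in>D. d \<in> {a \<in> carrier L. f a \<in> K}"
      using D by (auto simp: directed_in_def)
  qed
  ultimately show ?thesis by (simp add: scott_open_filters_def)
qed

theorem sigma_ext_eq_pi_ext:
  assumes L: "frame L" and M: "frame M"
    and X: "canonical_extension L X e" and Y: "canonical_extension M Y e'"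
    and f: "f \<in> carrier L \<rightarrow> carrier M" "isotone L M f"
    and pres: "directed_sup_pres L M f" "finite_meet_pres L M f"
  shows "sigma_ext L X e Y e' f = pi_ext L X e Y e' f"
proof
  fix u
  show "sigma_ext L X e Y e' f u = pi_ext L X e Y e' f u"
  proof (cases "u \<in> carrier X")
    case False
    then show ?thesis by (simp add: sigma_ext_def pi_ext_def)
  next
    case u: True
    have clX: "complete_lattice X" and clY: "complete_lattice Y"
      and e: "e \<in> carrier L \<rightarrow> carrier X" and e': "e' \<in> carrier M \<rightarrow> carrier Y"
      using X Y by (auto simp: canonical_extension_def)
    interpret X: complete_lattice X by fact
    interpret Y: complete_lattice Y by fact
    have subL: "K \<subseteq> carrier L" if "K \<in> scott_open_filters L" for K
      using that by (auto simp: scott_open_filters_def is_filter_def)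
    have subM: "K \<subseteq> carrier M" if "K \<in> scott_open_filters M" for K
      using that by (auto simp: scott_open_filters_def is_filter_def)
    have imX: "e ` K \<subseteq> carrier X" if "K \<in> scott_open_filters L" for K
      using subL[OF that] e by (auto simp: Pi_iff)
    have imY: "e' ` K \<subseteq> carrier Y" if "K \<in> scott_open_filters M" for K
      using subM[OF that] e' by (auto simp: Pi_iff)
    have imfY: "e' ` f ` K \<subseteq> carrier Y" if "K \<in> scott_open_filters L" for K
      using subL[OF that] e' f by (auto simp: Pi_iff)
    let ?S = "{\<Sqinter>\<^bsub>Y\<^esub>(e' ` f ` K) | K. K \<in> scott_open_filters L \<and> \<Sqinter>\<^bsub>X\<^esub>(e ` K) \<sqsubseteq>\<^bsub>X\<^esub> u}"
    let ?P = "{e' (f a) | a. a \<in> carrier L \<and> u \<sqsubseteq>\<^bsub>X\<^esub> e a}"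
    have S: "?S \<subseteq> carrier Y" using complete_lattice_inf(1)[OF clY] imfY by auto
    have P: "?P \<subseteq> carrier Y" using e' f by (auto simp: Pi_iff)
    note Sc = complete_lattice_sup[OF clY S]
    note Pc = complete_lattice_inf[OF clY P]
    have "\<Squnion>\<^bsub>Y\<^esub>?S \<sqsubseteq>\<^bsub>Y\<^esub> \<Sqinter>\<^bsub>Y\<^esub>?P"
    proof (rule Sc(3)[OF Pc(1)], rule Pc(3))
      fix s p assume "s \<in> ?S" "p \<in> ?P"
      then obtain K a where K: "K \<in> scott_open_filters L" "\<Sqinter>\<^bsub>X\<^esub>(e ` K) \<sqsubseteq>\<^bsub>X\<^esub> u"
          "s = \<Sqinter>\<^bsub>Y\<^esub>(e' ` f ` K)"
        and a: "a \<in> carrier L" "u \<sqsubseteq>\<^bsub>X\<^esub> e a" "p = e' (f a)" by blast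
      have "\<Sqinter>\<^bsub>X\<^esub>(e ` K) \<sqsubseteq>\<^bsub>X\<^esub> e a"
        using X.le_trans[OF K(2) a(2)] u a e complete_lattice_inf(1)[OF clX imX[OF K(1)]]
        by (auto simp: Pi_iff)
      then have "a \<in> K" using X K(1) a(1) by (auto simp: canonical_extension_def)
      then show "s \<sqsubseteq>\<^bsub>Y\<^esub> p"
        using complete_lattice_inf(2)[OF clY imfY[OF K(1)]] K a by auto
    qed (use S in auto)
    moreover have "\<Sqinter>\<^bsub>Y\<^esub>?P \<sqsubseteq>\<^bsub>Y\<^esub> \<Squnion>\<^bsub>Y\<^esub>?S"
    proof (rule canonical_extension_dense[OF Y Pc(1) Sc(1)])
      fix K b
      assume K: "K \<in> scott_open_filters M" and b: "b \<in> carrier M"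
        and KP: "\<Sqinter>\<^bsub>Y\<^esub>(e' ` K) \<sqsubseteq>\<^bsub>Y\<^esub> \<Sqinter>\<^bsub>Y\<^esub>?P" and Sb: "\<Squnion>\<^bsub>Y\<^esub>?S \<sqsubseteq>\<^bsub>Y\<^esub> e' b"
      show "\<Sqinter>\<^bsub>Y\<^esub>(e' ` K) \<sqsubseteq>\<^bsub>Y\<^esub> e' b"
      proof -
        let ?K = "{a \<in> carrier L. f a \<in> K}"
        have K': "?K \<in> scott_open_filters L"
          by (rule scott_open_filter_vimage[OF L M f pres K])
        note KX = complete_lattice_inf[OF clX imX[OF K']]
        note KY = complete_lattice_inf[OF clY imY[OF K]]
        have "\<Sqinter>\<^bsub>X\<^esub>(e ` ?K) \<sqsubseteq>\<^bsub>X\<^esub> u"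
        proof (rule canonical_extension_dense[OF X KX(1) u])
          fix K2 a
          assume K2: "K2 \<in> scott_open_filters L" and a: "a \<in> carrier L"
            and le: "\<Sqinter>\<^bsub>X\<^esub>(e ` K2) \<sqsubseteq>\<^bsub>X\<^esub> \<Sqinter>\<^bsub>X\<^esub>(e ` ?K)" and ua: "u \<sqsubseteq>\<^bsub>X\<^esub> e a"
          show "\<Sqinter>\<^bsub>X\<^esub>(e ` K2) \<sqsubseteq>\<^bsub>X\<^esub> e a"
          proof -
            have p: "e' (f a) \<in> ?P" using a ua by blast
            then have "\<Sqinter>\<^bsub>Y\<^esub>(e' ` K) \<sqsubseteq>\<^bsub>Y\<^esub> e' (f a)"
              using Y.le_trans[OF KP Pc(2)[OF p] KY(1) Pc(1)] P p by (simp add: subset_iff)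
            then have "f a \<in> K"
              using Y K a f by (auto simp: canonical_extension_def Pi_iff)
            then have "\<Sqinter>\<^bsub>X\<^esub>(e ` ?K) \<sqsubseteq>\<^bsub>X\<^esub> e a" using a by (intro KX(2)) auto
            then show ?thesis
              using X.le_trans[OF le _ complete_lattice_inf(1)[OF clX imX[OF K2]] KX(1)] a e
              by (auto simp: Pi_iff)
          qed
        qed
        then have s: "\<Sqinter>\<^bsub>Y\<^esub>(e' ` f ` ?K) \<in> ?S" using K' by blast
        have "\<Sqinter>\<^bsub>Y\<^esub>(e' ` K) \<sqsubseteq>\<^bsub>Y\<^esub> \<Sqinter>\<^bsub>Y\<^esub>(e' ` f ` ?K)"
          by (rule complete_lattice_inf(3)[OF clY imfY[OF K'] KY(1)]) (auto intro: KY(2))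
        then have "\<Sqinter>\<^bsub>Y\<^esub>(e' ` K) \<sqsubseteq>\<^bsub>Y\<^esub> \<Squnion>\<^bsub>Y\<^esub>?S"
          using Y.le_trans[OF _ Sc(2)[OF s] KY(1) subsetD[OF S s] Sc(1)] by simp
        then show ?thesis
          using Y.le_trans[OF _ Sb KY(1) Sc(1)] e' b by (simp add: Pi_iff)
      qed
    qed
    ultimately have "\<Squnion>\<^bsub>Y\<^esub>?S = \<Sqinter>\<^bsub>Y\<^esub>?P"
      using Sc(1) Pc(1) by (rule Y.le_antisym)
    then show ?thesis using u by (simp add: sigma_ext_def pi_ext_def)
  qed
qed

section \<open>Canonical extensions exist\<close>

text \<open>The subsets of \<^term>\<open>scott_open_filters L\<close> that are closed for the polarity given by
  membership form a canonical extension.\<close>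

theorem canonical_extensions_exist:
  "\<exists>(X :: 'a gorder \<Rightarrow> 'a set set gorder) e. \<forall>L. frame L \<longrightarrow> canonical_extension L (X L) (e L)"
proof -
  have "\<exists>(X :: 'a set set gorder) e. canonical_extension L X e" if "frame L" for L :: "'a gorder"
  proof -
    interpret L: frame L by fact
    define \<F> where "\<F> = scott_open_filters L"
    define e where "e a = {K \<in> \<F>. a \<in> K}" for a
    define C where "C = {\<F> \<inter> \<Inter>(e ` A) | A. A \<subseteq> carrier L}"
    define X :: "'a set set gorder" where "X = \<lparr>carrier = C, eq = (=), le = (\<subseteq>)\<rparr>"
    have sub: "K \<subseteq> carrier L" if "K \<in> \<F>" for K
      using that by (auto simp: \<F>_def scott_open_filters_def is_filter_def)
    have up: "y \<in> K" if "K \<in> \<F>" "x \<in> K" "x \<sqsubseteq>\<^bsub>L\<^esub> y" "y \<in> carrier L" for K x y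
      using that by (auto simp: \<F>_def scott_open_filters_def is_filter_def)
    have C_le: "u \<subseteq> \<F>" if "u \<in> C" for u using that by (auto simp: C_def)
    have C_eq: "u = \<F> \<inter> \<Inter>(e ` {a \<in> carrier L. u \<subseteq> e a})" if "u \<in> C" for u
    proof -
      obtain A where A: "A \<subseteq> carrier L" "u = \<F> \<inter> \<Inter>(e ` A)" using \<open>u \<in> C\<close> by (auto simp: C_def)
      then have "A \<subseteq> {a \<in> carrier L. u \<subseteq> e a}" by auto
      then show ?thesis using A(2) by blast
    qed
    have C_Inter: "\<F> \<inter> \<Inter>\<U> \<in> C" if "\<U> \<subseteq> C" for \<U>
    proof -
      have "\<F> \<inter> \<Inter>\<U> = \<F> \<inter> \<Inter>(e ` (\<Union>u\<in>\<U>. {a \<in> carrier L. u \<subseteq> e a}))" (is "?l = ?r")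
      proof
        show "?l \<subseteq> ?r" by auto
        show "?r \<subseteq> ?l"
        proof
          fix K assume K: "K \<in> ?r"
          have "K \<in> u" if "u \<in> \<U>" for u
          proof -
            have "u \<in> C" using that \<open>\<U> \<subseteq> C\<close> by blast
            moreover have "K \<in> \<F> \<inter> \<Inter>(e ` {a \<in> carrier L. u \<subseteq> e a})" using K that by blast
            ultimately show ?thesis using C_eq by blast
          qed
          then show "K \<in> ?l" using K by blast
        qed
      qed
      then show ?thesis unfolding C_def by blast
    qed
    have poX: "partial_order X"
      by unfold_locales (auto simp: X_def)
    then interpret X: partial_order X .
    have glb: "is_glb X (\<F> \<inter> \<Inter>\<U>) \<U>" if "\<U> \<subseteq> C" for \<U>
      using C_Inter[OF that] that C_le by (auto simp: greatest_def Lower_def X_def)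
    have lub: "is_lub X (\<F> \<inter> \<Inter>{v \<in> C. \<forall>u\<in>\<U>. u \<subseteq> v}) \<U>" if "\<U> \<subseteq> C" for \<U>
    proof -
      let ?V = "{v \<in> C. \<forall>u\<in>\<U>. u \<subseteq> v}"
      have "Upper X \<U> = ?V" using that by (auto simp: Upper_def X_def)
      moreover have "\<F> \<inter> \<Inter>?V \<in> ?V"
        using C_Inter[of ?V] that C_le by fast
      ultimately show ?thesis by (auto simp: least_def X_def)
    qed
    have clX: "complete_lattice X"
    proof (rule X.complete_latticeI)
      show "\<exists>s. is_lub X s \<U>" if "\<U> \<subseteq> carrier X" for \<U>
        using lub[of \<U>] that by (auto simp: X_def)
      show "\<exists>s. is_glb X s \<U>" if "\<U> \<subseteq> carrier X" for \<U>
        using glb[of \<U>] that by (auto simp: X_def)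
    qed
    then interpret X: complete_lattice X .
    have eC: "e a \<in> C" if "a \<in> carrier L" for a
      unfolding C_def using that by (auto intro!: exI[of _ "{a}"] simp: e_def)
    have inf_e: "\<Sqinter>\<^bsub>X\<^esub>(e ` K) = {K' \<in> \<F>. K \<subseteq> K'}" if "K \<in> \<F>" for K
    proof -
      have *: "e ` K \<subseteq> C" using eC sub[OF that] by blast
      have "is_glb X (\<Sqinter>\<^bsub>X\<^esub>(e ` K)) (e ` K)"
        by (rule X.inf_glb) (use * in \<open>simp add: X_def\<close>)
      then have "\<Sqinter>\<^bsub>X\<^esub>(e ` K) = \<F> \<inter> \<Inter>(e ` K)"
        using glb[OF *] X.greatest_unique by blast
      then show ?thesis by (auto simp: e_def)
    qed
    have "canonical_extension L X e"
      unfolding canonical_extension_def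
    proof (intro conjI ballI impI)
      show "complete_lattice X" by fact
      show "e \<in> carrier L \<rightarrow> carrier X" using eC by (auto simp: X_def)
      show "isotone L X e"
        unfolding isotone_def using up
        by (auto simp: X_def e_def L.weak_partial_order_axioms X.weak_partial_order_axioms[unfolded X_def])
    next
      fix u v assume uv: "u \<in> carrier X" "v \<in> carrier X"
        and *: "\<forall>K\<in>scott_open_filters L. \<forall>a\<in>carrier L.
           \<Sqinter>\<^bsub>X\<^esub>(e ` K) \<sqsubseteq>\<^bsub>X\<^esub> u \<and> v \<sqsubseteq>\<^bsub>X\<^esub> e a \<longrightarrow> \<Sqinter>\<^bsub>X\<^esub>(e ` K) \<sqsubseteq>\<^bsub>X\<^esub> e a"
      have C: "u \<in> C" "v \<in> C" using uv by (auto simp: X_def)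
      have "u \<subseteq> v"
      proof
        fix K assume K: "K \<in> u"
        then have KF: "K \<in> \<F>" using C_le C by blast
        obtain A where A: "u = \<F> \<inter> \<Inter>(e ` A)" using C by (auto simp: C_def)
        have le: "\<Sqinter>\<^bsub>X\<^esub>(e ` K) \<sqsubseteq>\<^bsub>X\<^esub> u"
          using K unfolding inf_e[OF KF] by (auto simp: X_def A e_def)
        have "K \<in> e a" if "a \<in> carrier L" "v \<subseteq> e a" for a
        proof -
          have "\<Sqinter>\<^bsub>X\<^esub>(e ` K) \<sqsubseteq>\<^bsub>X\<^esub> e a"
            using * KF that le by (auto simp: X_def \<F>_def)
          then show ?thesis using KF unfolding inf_e[OF KF] by (auto simp: X_def)
        qed
        then show "K \<in> v" using C_eq[OF C(2)] KF by blast
      qed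
      then show "u \<sqsubseteq>\<^bsub>X\<^esub> v" by (simp add: X_def)
    next
      fix K a assume "K \<in> scott_open_filters L" and le: "\<Sqinter>\<^bsub>X\<^esub>(e ` K) \<sqsubseteq>\<^bsub>X\<^esub> e a"
      then have KF: "K \<in> \<F>" by (simp add: \<F>_def)
      then show "a \<in> K" using le unfolding inf_e[OF KF] by (auto simp: X_def e_def)
    qed
    then show ?thesis by blast
  qed
  then show ?thesis by metis
qed

end

theory Submission
  imports Defs
begin

text \<open>By Zorn's lemma, every Scott-open filter of a frame is an intersection of completely prime
  filters. Hence in a canonical extension \<open>e : L \<rightarrow> X\<close> the elements \<open>k p = \<Sqinter>(e ` p)\<close>, for
  \<open>p\<close> completely prime, are join-dense. They are also completely join-prime, which makes \<open>X\<close>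
  completely distributive. For a frame homomorphism \<open>f : L \<rightarrow> M\<close>,
  the extension is determined by \<open>k q \<le> f\<^sup>\<delta> u \<longleftrightarrow> k (f\<^sup>-\<^sup>1 q) \<le> u\<close>, and preimages under \<open>f\<close> keep
  filters completely prime; so preservation of joins and meets and functoriality can be tested
  at the elements \<open>k q\<close>.\<close>

section \<open>Completely prime filters\<close>

text \<open>The case of empty \<open>A\<close> keeps the bottom element of a complete lattice out of
  \<open>p\<close>, so such filters are proper. In a frame they are the points, given by frame
  homomorphisms to the two-element lattice.\<close>

definition completely_prime :: "'a gorder \<Rightarrow> 'a set \<Rightarrow> bool" where
  "completely_prime L p \<longleftrightarrow> is_filter L p \<and>
     (\<forall>A. A \<subseteq> carrier L \<longrightarrow> \<Squnion>\<^bsub>L\<^esub>A \<in> p \<longrightarrow> (\<exists>a\<in>A. a \<in> p))"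

lemma completely_prime_scott_open_filter:
  "completely_prime L p \<Longrightarrow> p \<in> scott_open_filters L"
  by (auto simp: completely_prime_def scott_open_filters_def scott_open_def directed_in_def)

lemma scott_open_filter_subset: "K \<in> scott_open_filters L \<Longrightarrow> K \<subseteq> carrier L"
  by (simp add: scott_open_filters_def is_filter_def)

text \<open>The frame law for two-element joins, applied twice. This is the form in which
  distributivity makes a maximal element outside a filter meet-prime.\<close>

lemma (in frame) join_meet_distrib:
  assumes "x \<in> carrier L" "y \<in> carrier L" "b \<in> carrier L"
  shows "(x \<squnion> b) \<sqinter> (y \<squnion> b) \<sqsubseteq> (x \<sqinter> y) \<squnion> b"
proof -
  have distrib: "z \<sqinter> (v \<squnion> w) = (z \<sqinter> v) \<squnion> (z \<sqinter> w)"
    if "z \<in> carrier L" "v \<in> carrier L" "w \<in> carrier L" for z v w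
    using meet_sup_distrib[of z "{v, w}"] that by (simp add: join_def)
  have "(x \<squnion> b) \<sqinter> (y \<squnion> b) = ((x \<squnion> b) \<sqinter> y) \<squnion> ((x \<squnion> b) \<sqinter> b)"
    using assms by (simp add: distrib)
  also have "\<dots> \<sqsubseteq> (x \<sqinter> y) \<squnion> b"
  proof (rule join_le)
    have "(x \<squnion> b) \<sqinter> y = (y \<sqinter> x) \<squnion> (y \<sqinter> b)"
      using assms distrib by (simp add: meet_comm[of L _ y])
    also have "\<dots> \<sqsubseteq> (x \<sqinter> y) \<squnion> b"
    proof (rule join_le)
      show "y \<sqinter> x \<sqsubseteq> (x \<sqinter> y) \<squnion> b"
        using assms by (simp add: meet_comm[of L y] join_left)
      show "y \<sqinter> b \<sqsubseteq> (x \<sqinter> y) \<squnion> b"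
        using assms le_trans[OF meet_right join_right] by simp
    qed (use assms in auto)
    finally show "(x \<squnion> b) \<sqinter> y \<sqsubseteq> (x \<sqinter> y) \<squnion> b" .
    show "(x \<squnion> b) \<sqinter> b \<sqsubseteq> (x \<sqinter> y) \<squnion> b"
      using assms le_trans[OF meet_right join_right] by simp
  qed (use assms in auto)
  finally show ?thesis .
qed

text \<open>Primeness of \<open>b\<close> gives closure under meets. Complete primeness is
  automatic: if every member of \<open>A\<close> lies below \<open>b\<close>, then so does the join
  of \<open>A\<close>.\<close>

lemma completely_prime_not_le:
  fixes L :: "'a gorder" (structure)
  assumes L: "frame L"
    and b: "b \<in> carrier L" "\<not> \<top> \<sqsubseteq> b"
    and prime: "\<And>x y. \<lbrakk>x \<in> carrier L; y \<in> carrier L; x \<sqinter> y \<sqsubseteq> b\<rbrakk> \<Longrightarrow> x \<sqsubseteq> b \<or> y \<sqsubseteq> b"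
  shows "completely_prime L {x \<in> carrier L. \<not> x \<sqsubseteq> b}"
proof -
  interpret frame L by fact
  have "is_filter L {x \<in> carrier L. \<not> x \<sqsubseteq> b}"
    unfolding is_filter_def
  proof (intro conjI ballI impI)
    fix x y assume "x \<in> {x \<in> carrier L. \<not> x \<sqsubseteq> b}" "y \<in> carrier L" "x \<sqsubseteq> y"
    then show "y \<in> {x \<in> carrier L. \<not> x \<sqsubseteq> b}" using b(1) le_trans[of x y b] by auto
  qed (use b prime in auto)
  moreover have "\<exists>a\<in>A. a \<in> {x \<in> carrier L. \<not> x \<sqsubseteq> b}"
    if "A \<subseteq> carrier L" "\<Squnion>A \<in> {x \<in> carrier L. \<not> x \<sqsubseteq> b}" for A
  proof (rule ccontr)
    assume "\<not> ?thesis"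
    then have "\<Squnion>A \<sqsubseteq> b" using that(1) b(1) by (intro sup_least) auto
    then show False using that(2) by simp
  qed
  ultimately show ?thesis by (simp add: completely_prime_def)
qed

text \<open>Scott-openness lets Zorn's lemma produce a maximal \<open>m\<close> above
  \<open>a\<close> outside \<open>K\<close>. As \<open>K\<close> is a filter and the frame is
  distributive, \<open>m\<close> is meet-prime, and the elements not below \<open>m\<close> form the
  required \<open>p\<close>.\<close>

lemma completely_prime_separation:
  fixes L :: "'a gorder" (structure)
  assumes L: "frame L"
    and K: "K \<in> scott_open_filters L" and a: "a \<in> carrier L" "a \<notin> K"
  obtains p where "completely_prime L p" "K \<subseteq> p" "a \<notin> p"
proof -
  interpret frame L by fact
  have filt: "is_filter L K" and so: "scott_open L K"
    using K by (auto simp: scott_open_filters_def)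
  have up: "y \<in> K" if "x \<in> K" "x \<sqsubseteq> y" "y \<in> carrier L" for x y
    using filt that by (auto simp: is_filter_def)
  let ?A = "{b \<in> carrier L. a \<sqsubseteq> b \<and> b \<notin> K}"
  have "\<exists>m\<in>?A. \<forall>b\<in>?A. m \<sqsubseteq> b \<longrightarrow> b = m"
  proof (rule predicate_Zorn)
    show "partial_order_on ?A (relation_of (\<sqsubseteq>) ?A)"
      by (rule partial_order_on_relation_ofI) (auto intro: le_trans le_antisym)
    fix C assume C: "C \<in> Chains (relation_of (\<sqsubseteq>) ?A)"
    then have CA: "C \<subseteq> ?A" by (rule Chains_relation_of)
    then have CL: "C \<subseteq> carrier L" by blast
    show "\<exists>u\<in>?A. \<forall>c\<in>C. c \<sqsubseteq> u"
    \<comment> \<open>Directed sets are non-empty, so the empty chain is treated apart;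
      \<open>a\<close> itself bounds it.\<close>
    proof (cases "C = {}")
      case True
      then show ?thesis using a by auto
    next
      case False
      then obtain c where c: "c \<in> C" by blast
      \<comment> \<open>A non-empty chain is directed, so by Scott-openness its join stays outside
        \<open>K\<close> and is the bound that Zorn's lemma asks for.\<close>
      have "directed_in L C"
        unfolding directed_in_def
      proof (intro conjI ballI)
        fix x y assume xy: "x \<in> C" "y \<in> C"
        then have "x \<sqsubseteq> y \<or> y \<sqsubseteq> x" using C by (auto simp: Chains_def relation_of_def)
        moreover have "x \<sqsubseteq> x" "y \<sqsubseteq> y" using xy CL by auto
        ultimately show "\<exists>z\<in>C. x \<sqsubseteq> z \<and> y \<sqsubseteq> z" using xy by blast
      qed (use CL False in auto)
      then have "\<Squnion>C \<notin> K" using so CA unfolding scott_open_def by blast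
      moreover have "a \<sqsubseteq> \<Squnion>C"
        using le_trans[of a c "\<Squnion>C"] sup_upper[OF CL c] a c CA CL by auto
      moreover have "\<Squnion>C \<in> carrier L" "\<forall>c\<in>C. c \<sqsubseteq> \<Squnion>C"
        using CL sup_upper[OF CL] by auto
      ultimately show ?thesis by blast
    qed
  qed
  then obtain m where m: "m \<in> carrier L" "a \<sqsubseteq> m" "m \<notin> K"
    and max: "\<And>b. \<lbrakk>b \<in> carrier L; b \<notin> K; m \<sqsubseteq> b\<rbrakk> \<Longrightarrow> b = m"
    using a le_trans by (smt (verit, best) mem_Collect_eq)
  \<comment> \<open>Here \<open>x \<squnion> m\<close> lies strictly above \<open>m\<close>, so
    maximality of \<open>m\<close> forces it into \<open>K\<close>.\<close>
  have in_K: "x \<squnion> m \<in> K" if "x \<in> carrier L" "\<not> x \<sqsubseteq> m" for x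
    using max[of "x \<squnion> m"] that m(1) join_left[of x m] join_right[of x m] by auto
  have "completely_prime L {x \<in> carrier L. \<not> x \<sqsubseteq> m}"
  proof (rule completely_prime_not_le[OF L])
    show "\<not> \<top> \<sqsubseteq> m" using up filt m by (auto simp: is_filter_def)
    fix x y assume xy: "x \<in> carrier L" "y \<in> carrier L" "x \<sqinter> y \<sqsubseteq> m"
    show "x \<sqsubseteq> m \<or> y \<sqsubseteq> m"
    proof (rule ccontr)
      assume "\<not> (x \<sqsubseteq> m \<or> y \<sqsubseteq> m)"
      \<comment> \<open>Both joins are in the filter \<open>K\<close>, hence so is their meet; by
        distributivity it lies below \<open>(x \<sqinter> y) \<squnion> m\<close>, hence below
        \<open>m\<close>, which would put \<open>m\<close> into \<open>K\<close>.\<close>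
      then have "(x \<squnion> m) \<sqinter> (y \<squnion> m) \<in> K"
        using filt in_K xy by (auto simp: is_filter_def)
      moreover have "(x \<squnion> m) \<sqinter> (y \<squnion> m) \<sqsubseteq> m"
        using le_trans[OF join_meet_distrib[of x y m] join_le[of "x \<sqinter> y" m m]] xy m by simp
      ultimately show False using up m by blast
    qed
  qed (use m in auto)
  moreover have "K \<subseteq> {x \<in> carrier L. \<not> x \<sqsubseteq> m}"
    using up m scott_open_filter_subset[OF K] by blast
  ultimately show thesis using that m by blast
qed

section \<open>Points of a canonical extension\<close>

locale frame_extension = L: frame L for L :: "'a gorder" +
  fixes X :: "'b gorder" and e :: "'a \<Rightarrow> 'b"
  assumes can_ext: "canonical_extension L X e"
begin

sublocale X: complete_lattice X
  using can_ext by (simp add: canonical_extension_def)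

text \<open>For Scott-open \<open>K\<close> these are the filter elements of the canonical
  extension; for completely prime \<open>K\<close> they serve as its points.\<close>

definition k :: "'a set \<Rightarrow> 'b" where "k K = \<Sqinter>\<^bsub>X\<^esub>(e ` K)"

lemma e_closed [simp]: "a \<in> carrier L \<Longrightarrow> e a \<in> carrier X"
  using can_ext by (auto simp: canonical_extension_def)

lemma image_e_subset: "K \<in> scott_open_filters L \<Longrightarrow> e ` K \<subseteq> carrier X"
  using scott_open_filter_subset by fastforce

lemma k_closed [simp]: "K \<in> scott_open_filters L \<Longrightarrow> k K \<in> carrier X"
  unfolding k_def by (intro X.inf_closed image_e_subset)

text \<open>One direction is (Compact), the other holds because \<open>k K\<close> is a lower bound
  of the image of \<open>K\<close>.\<close>

lemma k_le_e_iff: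
  assumes "K \<in> scott_open_filters L" "a \<in> carrier L"
  shows "k K \<sqsubseteq>\<^bsub>X\<^esub> e a \<longleftrightarrow> a \<in> K"
proof
  show "k K \<sqsubseteq>\<^bsub>X\<^esub> e a \<Longrightarrow> a \<in> K"
    using can_ext assms by (auto simp: canonical_extension_def k_def)
  show "a \<in> K \<Longrightarrow> k K \<sqsubseteq>\<^bsub>X\<^esub> e a"
    unfolding k_def using image_e_subset[OF assms(1)] by (intro X.inf_lower) auto
qed

lemma k_antimono:
  assumes "K \<in> scott_open_filters L" "K' \<in> scott_open_filters L" "K \<subseteq> K'"
  shows "k K' \<sqsubseteq>\<^bsub>X\<^esub> k K"
proof -
  have "k K' \<sqsubseteq>\<^bsub>X\<^esub> e a" if "a \<in> K" for a
    using that assms k_le_e_iff[OF assms(2)] scott_open_filter_subset[OF assms(1)] by blast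
  then show ?thesis
    unfolding k_def[of K] using assms by (intro X.inf_greatest image_e_subset) auto
qed

text \<open>By (Dense), a filter element cannot distinguish \<open>u\<close> from the meet of all
  \<open>e a\<close> above \<open>u\<close>. The test at \<open>K'\<close> and \<open>a\<close>
  succeeds because \<open>k K'\<close> lies below \<open>k K\<close>, and \<open>k K\<close> lies
  below \<open>e a\<close> as soon as \<open>a \<in> K\<close>.\<close>

lemma k_le_iff:
  assumes K: "K \<in> scott_open_filters L" and u: "u \<in> carrier X"
  shows "k K \<sqsubseteq>\<^bsub>X\<^esub> u \<longleftrightarrow> (\<forall>a\<in>carrier L. u \<sqsubseteq>\<^bsub>X\<^esub> e a \<longrightarrow> a \<in> K)"
proof
  show "\<forall>a\<in>carrier L. u \<sqsubseteq>\<^bsub>X\<^esub> e a \<longrightarrow> a \<in> K" if "k K \<sqsubseteq>\<^bsub>X\<^esub> u"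
    using that K u X.le_trans[OF that] k_le_e_iff[OF K] by (meson e_closed k_closed)
  assume *: "\<forall>a\<in>carrier L. u \<sqsubseteq>\<^bsub>X\<^esub> e a \<longrightarrow> a \<in> K"
  show "k K \<sqsubseteq>\<^bsub>X\<^esub> u"
  proof (rule canonical_extension_dense[OF can_ext k_closed[OF K] u], fold k_def)
    fix K' a assume "K' \<in> scott_open_filters L" "a \<in> carrier L" "k K' \<sqsubseteq>\<^bsub>X\<^esub> k K" "u \<sqsubseteq>\<^bsub>X\<^esub> e a"
    then show "k K' \<sqsubseteq>\<^bsub>X\<^esub> e a"
      using * K X.le_trans[of "k K'" "k K" "e a"] by (simp add: k_le_e_iff)
  qed
qed

text \<open>Join-density of the points. If (Dense) failed at \<open>K\<close> and \<open>a\<close>,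
  a completely prime \<open>p\<close> would contain \<open>K\<close> but not \<open>a\<close>. Then
  \<open>k p\<close> lies below \<open>k K\<close>, hence below \<open>u\<close>, hence below
  \<open>v\<close> and \<open>e a\<close>, which forces \<open>a \<in> p\<close>.\<close>

lemma le_by_points:
  assumes u: "u \<in> carrier X" and v: "v \<in> carrier X"
    and le: "\<And>p. \<lbrakk>completely_prime L p; k p \<sqsubseteq>\<^bsub>X\<^esub> u\<rbrakk> \<Longrightarrow> k p \<sqsubseteq>\<^bsub>X\<^esub> v"
  shows "u \<sqsubseteq>\<^bsub>X\<^esub> v"
proof (rule canonical_extension_dense[OF can_ext u v], fold k_def)
  fix K a
  assume K: "K \<in> scott_open_filters L" and a: "a \<in> carrier L"
    and Ku: "k K \<sqsubseteq>\<^bsub>X\<^esub> u" and va: "v \<sqsubseteq>\<^bsub>X\<^esub> e a"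
  show "k K \<sqsubseteq>\<^bsub>X\<^esub> e a"
  proof (rule ccontr)
    assume "\<not> k K \<sqsubseteq>\<^bsub>X\<^esub> e a"
    then have "a \<notin> K" using K a by (simp add: k_le_e_iff)
    then obtain p where p: "completely_prime L p" "K \<subseteq> p" "a \<notin> p"
      using completely_prime_separation[OF L.frame_axioms K a] by blast
    note sof = completely_prime_scott_open_filter[OF p(1)]
    have "k p \<sqsubseteq>\<^bsub>X\<^esub> u" using X.le_trans[OF k_antimono[OF K sof p(2)] Ku] K sof u by simp
    then have "k p \<sqsubseteq>\<^bsub>X\<^esub> e a" using X.le_trans[OF le[OF p(1)] va] sof v a by simp
    then show False using p sof a by (simp add: k_le_e_iff)
  qed
qed

lemma eq_by_points:
  assumes "u \<in> carrier X" "v \<in> carrier X"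
    and "\<And>p. completely_prime L p \<Longrightarrow> k p \<sqsubseteq>\<^bsub>X\<^esub> u \<longleftrightarrow> k p \<sqsubseteq>\<^bsub>X\<^esub> v"
  shows "u = v"
  by (rule X.le_antisym; (rule le_by_points)?) (simp_all add: assms)

lemma k_le_inf_iff:
  assumes "K \<in> scott_open_filters L" "S \<subseteq> carrier X"
  shows "k K \<sqsubseteq>\<^bsub>X\<^esub> \<Sqinter>\<^bsub>X\<^esub>S \<longleftrightarrow> (\<forall>s\<in>S. k K \<sqsubseteq>\<^bsub>X\<^esub> s)"
proof
  assume "k K \<sqsubseteq>\<^bsub>X\<^esub> \<Sqinter>\<^bsub>X\<^esub>S"
  then show "\<forall>s\<in>S. k K \<sqsubseteq>\<^bsub>X\<^esub> s"
    using assms X.le_trans[OF _ X.inf_lower[OF assms(2)]] by auto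
qed (use assms in \<open>auto intro: X.inf_greatest\<close>)

text \<open>Points are completely join-prime. If \<open>k p\<close> is below no member of
  \<open>S\<close>, each \<open>s\<close> is bounded by some \<open>e a\<close> with
  \<open>a \<notin> p\<close>. The join of these \<open>a\<close> is again outside \<open>p\<close>,
  while its image under \<open>e\<close> bounds all of \<open>S\<close>.\<close>

lemma k_le_sup_iff:
  assumes p: "completely_prime L p" and S: "S \<subseteq> carrier X"
  shows "k p \<sqsubseteq>\<^bsub>X\<^esub> \<Squnion>\<^bsub>X\<^esub>S \<longleftrightarrow> (\<exists>s\<in>S. k p \<sqsubseteq>\<^bsub>X\<^esub> s)"
proof
  note sof = completely_prime_scott_open_filter[OF p]
  show "k p \<sqsubseteq>\<^bsub>X\<^esub> \<Squnion>\<^bsub>X\<^esub>S" if "\<exists>s\<in>S. k p \<sqsubseteq>\<^bsub>X\<^esub> s"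
    using that S sof X.le_trans[OF _ X.sup_upper[OF S]] by auto
  assume le: "k p \<sqsubseteq>\<^bsub>X\<^esub> \<Squnion>\<^bsub>X\<^esub>S"
  show "\<exists>s\<in>S. k p \<sqsubseteq>\<^bsub>X\<^esub> s"
  proof (rule ccontr)
    assume "\<not> ?thesis"
    then have "\<forall>s\<in>S. \<exists>a\<in>carrier L. s \<sqsubseteq>\<^bsub>X\<^esub> e a \<and> a \<notin> p"
      using k_le_iff[OF sof] S by (simp add: subset_iff)
    \<comment> \<open>The axiom of choice picks one bound for each member of
      \<open>S\<close>.\<close>
    then obtain b where b: "\<And>s. s \<in> S \<Longrightarrow> b s \<in> carrier L \<and> s \<sqsubseteq>\<^bsub>X\<^esub> e (b s) \<and> b s \<notin> p"
      by metis
    then have bS: "b ` S \<subseteq> carrier L" by blast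
    have "s \<sqsubseteq>\<^bsub>X\<^esub> e (\<Squnion>\<^bsub>L\<^esub>(b ` S))" if "s \<in> S" for s
    proof -
      have "e (b s) \<sqsubseteq>\<^bsub>X\<^esub> e (\<Squnion>\<^bsub>L\<^esub>(b ` S))"
        using can_ext L.sup_upper[OF bS imageI[OF that]] b[OF that] L.sup_closed[OF bS]
        by (simp add: canonical_extension_def isotone_def)
      then show ?thesis using X.le_trans[of s "e (b s)"] b[OF that] S bS that by auto
    qed
    then have "\<Squnion>\<^bsub>X\<^esub>S \<sqsubseteq>\<^bsub>X\<^esub> e (\<Squnion>\<^bsub>L\<^esub>(b ` S))"
      using S bS by (intro X.sup_least) auto
    then have "\<Squnion>\<^bsub>L\<^esub>(b ` S) \<in> p"
      using le k_le_iff[OF sof] S bS by simp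
    then show False using p bS b unfolding completely_prime_def by blast
  qed
qed

text \<open>Below either side, a point \<open>k p\<close> says the same: every
  \<open>S \<in> \<S>\<close> has a member above \<open>k p\<close>. For the right-hand side this
  uses complete join-primeness and the axiom of choice.\<close>

lemma completely_distributive: "completely_distributive_lattice X"
proof unfold_locales
  fix \<S> assume S: "\<S> \<subseteq> Pow (carrier X)"
  have sups: "(\<lambda>S. \<Squnion>\<^bsub>X\<^esub>S) ` \<S> \<subseteq> carrier X" using S by auto
  have c: "c ` \<S> \<subseteq> carrier X" if "c \<in> (\<Pi>\<^sub>E S\<in>\<S>. S)" for c
    using that S by (fastforce simp: PiE_iff)
  then have infs: "(\<lambda>c. \<Sqinter>\<^bsub>X\<^esub>(c ` \<S>)) ` (\<Pi>\<^sub>E S\<in>\<S>. S) \<subseteq> carrier X" by auto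
  show "\<Sqinter>\<^bsub>X\<^esub>((\<lambda>S. \<Squnion>\<^bsub>X\<^esub>S) ` \<S>) = \<Squnion>\<^bsub>X\<^esub>((\<lambda>c. \<Sqinter>\<^bsub>X\<^esub>(c ` \<S>)) ` (\<Pi>\<^sub>E S\<in>\<S>. S))"
  proof (rule eq_by_points)
    fix p assume p: "completely_prime L p"
    note sof = completely_prime_scott_open_filter[OF p]
    have "k p \<sqsubseteq>\<^bsub>X\<^esub> \<Sqinter>\<^bsub>X\<^esub>((\<lambda>S. \<Squnion>\<^bsub>X\<^esub>S) ` \<S>) \<longleftrightarrow> (\<forall>S\<in>\<S>. \<exists>s\<in>S. k p \<sqsubseteq>\<^bsub>X\<^esub> s)"
      using S by (simp add: k_le_inf_iff[OF sof sups] k_le_sup_iff[OF p] subset_iff)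
    also have "\<dots> \<longleftrightarrow> (\<exists>c\<in>\<Pi>\<^sub>E S\<in>\<S>. S. \<forall>S\<in>\<S>. k p \<sqsubseteq>\<^bsub>X\<^esub> c S)"
    proof
      assume "\<forall>S\<in>\<S>. \<exists>s\<in>S. k p \<sqsubseteq>\<^bsub>X\<^esub> s"
      then obtain c where "\<And>S. S \<in> \<S> \<Longrightarrow> c S \<in> S \<and> k p \<sqsubseteq>\<^bsub>X\<^esub> c S" by metis
      then show "\<exists>c\<in>\<Pi>\<^sub>E S\<in>\<S>. S. \<forall>S\<in>\<S>. k p \<sqsubseteq>\<^bsub>X\<^esub> c S"
        \<comment> \<open>The restriction makes the choice function extensional, as
          \<open>\<Pi>\<^sub>E\<close> demands.\<close>
        by (intro bexI[of _ "restrict c \<S>"]) auto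
    qed (auto simp: PiE_iff)
    also have "\<dots> \<longleftrightarrow> k p \<sqsubseteq>\<^bsub>X\<^esub> \<Squnion>\<^bsub>X\<^esub>((\<lambda>c. \<Sqinter>\<^bsub>X\<^esub>(c ` \<S>)) ` (\<Pi>\<^sub>E S\<in>\<S>. S))"
      by (simp add: k_le_sup_iff[OF p infs] k_le_inf_iff[OF sof c])
    finally show "k p \<sqsubseteq>\<^bsub>X\<^esub> \<Sqinter>\<^bsub>X\<^esub>((\<lambda>S. \<Squnion>\<^bsub>X\<^esub>S) ` \<S>) \<longleftrightarrow>
      k p \<sqsubseteq>\<^bsub>X\<^esub> \<Squnion>\<^bsub>X\<^esub>((\<lambda>c. \<Sqinter>\<^bsub>X\<^esub>(c ` \<S>)) ` (\<Pi>\<^sub>E S\<in>\<S>. S))" .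
  qed (use sups infs in auto)
qed

end

section \<open>Extensions of frame homomorphisms\<close>

lemma frame_hom_isotone: "frame_hom L M f \<Longrightarrow> isotone L M f"
  unfolding frame_hom_def
  by (intro join_pres_isotone sup_pres_is_join_pres weak_sup_pres) auto

lemma frame_hom_directed_sup_pres: "frame_hom L M f \<Longrightarrow> directed_sup_pres L M f"
  by (auto simp: frame_hom_def sup_pres_def directed_sup_pres_def directed_in_def)

lemma frame_hom_scott_open_filter_vimage:
  assumes "frame L" "frame M" "frame_hom L M f" "K \<in> scott_open_filters M"
  shows "{a \<in> carrier L. f a \<in> K} \<in> scott_open_filters L"
  using assms frame_hom_isotone[OF assms(3)] frame_hom_directed_sup_pres[OF assms(3)]
  by (intro scott_open_filter_vimage[of L M]) (auto simp: frame_hom_def)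

text \<open>Since \<open>f\<close> preserves arbitrary joins, a join in the preimage becomes a join
  in \<open>q\<close>, where complete primeness of \<open>q\<close> selects a member.\<close>

lemma completely_prime_vimage:
  assumes L: "frame L" and M: "frame M" and f: "frame_hom L M f" and q: "completely_prime M q"
  shows "completely_prime L {a \<in> carrier L. f a \<in> q}"
proof -
  have "is_filter L {a \<in> carrier L. f a \<in> q}"
    using frame_hom_scott_open_filter_vimage[OF L M f completely_prime_scott_open_filter[OF q]]
    by (simp add: scott_open_filters_def)
  moreover have "\<exists>a\<in>A. a \<in> {a \<in> carrier L. f a \<in> q}"
    if A: "A \<subseteq> carrier L" "\<Squnion>\<^bsub>L\<^esub>A \<in> {a \<in> carrier L. f a \<in> q}" for A
  proof -
    have "\<Squnion>\<^bsub>M\<^esub>(f ` A) \<in> q" "f ` A \<subseteq> carrier M"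
      using A f by (auto simp: frame_hom_def sup_pres_def)
    then obtain a where "a \<in> A" "f a \<in> q"
      using q unfolding completely_prime_def by blast
    then show ?thesis using A by blast
  qed
  ultimately show ?thesis by (simp add: completely_prime_def)
qed

locale frame_hom_extension =
  L: frame_extension L X e + M: frame_extension M Y e'
  for L :: "'a gorder" and X :: "'b gorder" and e :: "'a \<Rightarrow> 'b"
    and M :: "'c gorder" and Y :: "'d gorder" and e' :: "'c \<Rightarrow> 'd" +
  fixes f :: "'a \<Rightarrow> 'c"
  assumes hom: "frame_hom L M f"
begin

abbreviation "\<delta> \<equiv> delta_ext L X e Y e' f"

lemma f_closed [simp]: "a \<in> carrier L \<Longrightarrow> f a \<in> carrier M"
  using hom by (auto simp: frame_hom_def)

text \<open>The agreement of the two extensions is used to replace the join defining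
  \<open>delta_ext\<close> by a meet, below which filter elements can be tested one \<open>a\<close>
  at a time.\<close>

lemma delta_eq: "u \<in> carrier X \<Longrightarrow> \<delta> u = \<Sqinter>\<^bsub>Y\<^esub>{e' (f a) | a. a \<in> carrier L \<and> u \<sqsubseteq>\<^bsub>X\<^esub> e a}"
  using sigma_ext_eq_pi_ext[OF L.L.frame_axioms M.L.frame_axioms L.can_ext M.can_ext _
      frame_hom_isotone[OF hom] frame_hom_directed_sup_pres[OF hom]] hom
  by (simp add: delta_ext_def pi_ext_def frame_hom_def)

lemma delta_closed [simp]: "u \<in> carrier X \<Longrightarrow> \<delta> u \<in> carrier Y"
  by (subst delta_eq) (auto intro!: M.X.inf_closed)

text \<open>Both sides unfold to the same condition: \<open>f a \<in> K\<close> whenever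
  \<open>u\<close> lies below \<open>e a\<close>. For the right-hand side this is
  \<open>k_le_iff\<close> at the preimage of \<open>K\<close>, which is Scott-open.\<close>

lemma k_le_delta_iff:
  assumes K: "K \<in> scott_open_filters M" and u: "u \<in> carrier X"
  shows "M.k K \<sqsubseteq>\<^bsub>Y\<^esub> \<delta> u \<longleftrightarrow> L.k {a \<in> carrier L. f a \<in> K} \<sqsubseteq>\<^bsub>X\<^esub> u"
proof -
  let ?P = "{e' (f a) | a. a \<in> carrier L \<and> u \<sqsubseteq>\<^bsub>X\<^esub> e a}"
  have "?P \<subseteq> carrier Y" by auto
  then have "M.k K \<sqsubseteq>\<^bsub>Y\<^esub> \<delta> u \<longleftrightarrow> (\<forall>a\<in>carrier L. u \<sqsubseteq>\<^bsub>X\<^esub> e a \<longrightarrow> M.k K \<sqsubseteq>\<^bsub>Y\<^esub> e' (f a))"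
    by (auto simp: delta_eq[OF u] M.k_le_inf_iff[OF K])
  also have "\<dots> \<longleftrightarrow> L.k {a \<in> carrier L. f a \<in> K} \<sqsubseteq>\<^bsub>X\<^esub> u"
    using frame_hom_scott_open_filter_vimage[OF L.L.frame_axioms M.L.frame_axioms hom K] u
    by (simp add: L.k_le_iff M.k_le_e_iff[OF K])
  finally show ?thesis .
qed

text \<open>The preimage of a completely prime \<open>q\<close> is completely prime, so both
  \<open>M.k q\<close> and the corresponding point of \<open>X\<close> are completely
  join-prime.\<close>

lemma delta_sup:
  assumes S: "S \<subseteq> carrier X"
  shows "\<delta> (\<Squnion>\<^bsub>X\<^esub>S) = \<Squnion>\<^bsub>Y\<^esub>(\<delta> ` S)"
proof (rule M.eq_by_points)
  fix q assume q: "completely_prime M q"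
  have dS: "\<delta> ` S \<subseteq> carrier Y" using S by auto
  show "M.k q \<sqsubseteq>\<^bsub>Y\<^esub> \<delta> (\<Squnion>\<^bsub>X\<^esub>S) \<longleftrightarrow> M.k q \<sqsubseteq>\<^bsub>Y\<^esub> \<Squnion>\<^bsub>Y\<^esub>(\<delta> ` S)"
    using S L.k_le_sup_iff[OF completely_prime_vimage[OF L.L.frame_axioms M.L.frame_axioms hom q] S]
    by (auto simp: M.k_le_sup_iff[OF q dS] k_le_delta_iff completely_prime_scott_open_filter[OF q]
        subset_iff)
qed (use S in \<open>auto intro!: M.X.sup_closed\<close>)

text \<open>Lying below a meet means lying below each member, and \<open>k_le_delta_iff\<close>
  translates this between \<open>Y\<close> and \<open>X\<close>.\<close>

lemma delta_inf:
  assumes S: "S \<subseteq> carrier X"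
  shows "\<delta> (\<Sqinter>\<^bsub>X\<^esub>S) = \<Sqinter>\<^bsub>Y\<^esub>(\<delta> ` S)"
proof (rule M.eq_by_points)
  fix q assume q: "completely_prime M q"
  note sof = completely_prime_scott_open_filter[OF q]
  have dS: "\<delta> ` S \<subseteq> carrier Y" using S by auto
  show "M.k q \<sqsubseteq>\<^bsub>Y\<^esub> \<delta> (\<Sqinter>\<^bsub>X\<^esub>S) \<longleftrightarrow> M.k q \<sqsubseteq>\<^bsub>Y\<^esub> \<Sqinter>\<^bsub>Y\<^esub>(\<delta> ` S)"
    using S L.k_le_inf_iff[OF
        frame_hom_scott_open_filter_vimage[OF L.L.frame_axioms M.L.frame_axioms hom sof] S]
    by (auto simp: M.k_le_inf_iff[OF sof dS] k_le_delta_iff[OF sof] subset_iff)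
qed (use S in \<open>auto intro!: M.X.inf_closed\<close>)

lemma delta_complete_lattice_hom: "complete_lattice_hom X Y \<delta>"
  unfolding complete_lattice_hom_def sup_pres_def inf_pres_def
  using delta_sup delta_inf L.X.complete_lattice_axioms M.X.complete_lattice_axioms by auto

end

section \<open>The two categories\<close>

text \<open>Arrows are made extensional by cutting them off outside the carrier; images of subsets
  of the carrier do not see the cut-off.\<close>

lemma image_compose: "A \<subseteq> B \<Longrightarrow> compose B g f ` A = g ` f ` A"
  by (auto simp: compose_def image_image intro!: image_cong)

lemma image_restrict: "A \<subseteq> B \<Longrightarrow> restrict f B ` A = f ` A"
  by (auto simp: subset_iff intro!: image_cong)

section \<open>Generated filters and perfect maps\<close>

lemma generated_filter_mono: "S \<subseteq> T \<Longrightarrow> generated_filter L S \<subseteq> generated_filter L T"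
  by (auto simp: generated_filter_def)

lemma generated_filter_superset: "S \<subseteq> generated_filter L S"
  by (auto simp: generated_filter_def)

lemma generated_filter_least: "\<lbrakk>is_filter L K; S \<subseteq> K\<rbrakk> \<Longrightarrow> generated_filter L S \<subseteq> K"
  by (auto simp: generated_filter_def)

lemma is_filter_generated_filter:
  assumes "complete_lattice L" "S \<subseteq> carrier L"
  shows "is_filter L (generated_filter L S)"
proof -
  interpret complete_lattice L by fact
  \<comment> \<open>The improper filter belongs to the family being intersected; an empty family
    would give the whole type.\<close>
  have "is_filter L (carrier L)" by (auto simp: is_filter_def)
  then have "generated_filter L S \<subseteq> carrier L" using assms(2) by (rule generated_filter_least)
  then show ?thesis
    unfolding is_filter_def
  proof (intro conjI ballI impI)
    fix x y
    assume x: "x \<in> generated_filter L S"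
    show "y \<in> generated_filter L S" if "y \<in> carrier L" "x \<sqsubseteq>\<^bsub>L\<^esub> y"
      using x that unfolding generated_filter_def is_filter_def by auto
    show "x \<sqinter>\<^bsub>L\<^esub> y \<in> generated_filter L S" if "y \<in> generated_filter L S"
      using x that unfolding generated_filter_def is_filter_def by auto
  next
    show "\<top>\<^bsub>L\<^esub> \<in> generated_filter L S"
      by (auto simp: generated_filter_def is_filter_def)
  qed
qed

lemma generated_filter_image:
  assumes L: "complete_lattice L" and M: "complete_lattice M"
    and g: "g \<in> carrier L \<rightarrow> carrier M" "isotone L M g" "finite_meet_pres L M g"
    and S: "S \<subseteq> carrier L"
  shows "generated_filter M (g ` generated_filter L S) = generated_filter M (g ` S)"
proof
  interpret L: complete_lattice L by fact
  interpret M: complete_lattice M by fact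
  let ?G = "generated_filter M (g ` S)"
  have G: "is_filter M ?G"
    using g S by (intro is_filter_generated_filter[OF M]) auto
  have "is_filter L {x \<in> carrier L. g x \<in> ?G}"
    using G g unfolding is_filter_def
    by (auto simp: isotone_def finite_meet_pres_def meet_pres_def Pi_iff)
  moreover have "S \<subseteq> {x \<in> carrier L. g x \<in> ?G}"
    using S generated_filter_superset[of "g ` S" M] by auto
  ultimately have "generated_filter L S \<subseteq> {x \<in> carrier L. g x \<in> ?G}"
    by (rule generated_filter_least)
  then show "generated_filter M (g ` generated_filter L S) \<subseteq> ?G"
    by (intro generated_filter_least[OF G]) auto
  show "?G \<subseteq> generated_filter M (g ` generated_filter L S)"
    by (intro generated_filter_mono image_mono generated_filter_superset)
qed

text \<open>A filter generates itself.\<close>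

lemma perfect_map_id: "complete_lattice L \<Longrightarrow> perfect_map L L (\<lambda>x\<in>carrier L. x)"
proof -
  assume "complete_lattice L"
  then interpret complete_lattice L .
  have "scott_open L (generated_filter L ((\<lambda>x\<in>carrier L. x) ` K))"
    if "K \<in> scott_open_filters L" for K
  proof -
    have "(\<lambda>x\<in>carrier L. x) ` K = K" using scott_open_filter_subset[OF that] by force
    moreover have "generated_filter L K = K"
      using that generated_filter_least[of L K K] generated_filter_superset[of K L]
      by (auto simp: scott_open_filters_def)
    ultimately show ?thesis using that by (simp add: scott_open_filters_def)
  qed
  then show ?thesis
    using weak_partial_order_axioms by (auto simp: perfect_map_def isotone_def)
qed

lemma perfect_map_compose:
  assumes f: "perfect_map L M f" and g: "perfect_map M N g" "finite_meet_pres M N g"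
    and M: "complete_lattice M" and N: "complete_lattice N"
  shows "perfect_map L N (compose (carrier L) g f)"
proof -
  have "scott_open N (generated_filter N (compose (carrier L) g f ` K))"
    if K: "K \<in> scott_open_filters L" for K
  proof -
    have KL: "K \<subseteq> carrier L" using K by (rule scott_open_filter_subset)
    have fK: "f ` K \<subseteq> carrier M" using KL f by (auto simp: perfect_map_def)
    have "generated_filter M (f ` K) \<in> scott_open_filters M"
      using f K is_filter_generated_filter[OF M fK]
      by (simp add: scott_open_filters_def perfect_map_def)
    then have "scott_open N (generated_filter N (g ` generated_filter M (f ` K)))"
      using g by (simp add: perfect_map_def)
    moreover have "compose (carrier L) g f ` K = g ` f ` K"
      using KL by (rule image_compose)
    ultimately show ?thesis
      using generated_filter_image[OF M N _ _ g(2) fK] g by (simp add: perfect_map_def)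
  qed
  then show ?thesis
    using f g by (auto simp: perfect_map_def isotone_def compose_def Pi_iff)
qed

section \<open>Identities and composites of homomorphisms\<close>

lemma sup_pres_id:
  assumes L: "complete_lattice L"
  shows "sup_pres L L (\<lambda>x\<in>carrier L. x)"
  unfolding sup_pres_def
proof (intro conjI allI impI)
  fix A assume A: "A \<subseteq> carrier L"
  show "(\<lambda>x\<in>carrier L. x) (\<Squnion>\<^bsub>L\<^esub>A) = \<Squnion>\<^bsub>L\<^esub>((\<lambda>x\<in>carrier L. x) ` A)"
    by (simp only: image_restrict[OF A] restrict_apply' complete_lattice_sup(1)[OF L A] image_ident)
qed (use L in auto)

lemma inf_pres_id:
  assumes L: "complete_lattice L"
  shows "inf_pres L L (\<lambda>x\<in>carrier L. x)"
  unfolding inf_pres_def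
proof (intro conjI allI impI)
  fix A assume A: "A \<subseteq> carrier L"
  show "(\<lambda>x\<in>carrier L. x) (\<Sqinter>\<^bsub>L\<^esub>A) = \<Sqinter>\<^bsub>L\<^esub>((\<lambda>x\<in>carrier L. x) ` A)"
    by (simp only: image_restrict[OF A] restrict_apply' complete_lattice_inf(1)[OF L A] image_ident)
qed (use L in auto)

lemma sup_pres_compose:
  assumes f: "f \<in> carrier L \<rightarrow> carrier M" "sup_pres L M f" and g: "sup_pres M N g"
  shows "sup_pres L N (compose (carrier L) g f)"
  unfolding sup_pres_def
proof (intro conjI allI impI)
  show L: "complete_lattice L" and "complete_lattice N"
    using f g by (auto simp: sup_pres_def)
  fix A assume A: "A \<subseteq> carrier L"
  then have "f ` A \<subseteq> carrier M" using f by auto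
  then show "compose (carrier L) g f (\<Squnion>\<^bsub>L\<^esub>A) = \<Squnion>\<^bsub>N\<^esub>(compose (carrier L) g f ` A)"
    using f g A complete_lattice_sup(1)[OF L A]
    by (simp add: sup_pres_def image_compose compose_eq)
qed

lemma inf_pres_compose:
  assumes f: "f \<in> carrier L \<rightarrow> carrier M" "inf_pres L M f" and g: "inf_pres M N g"
  shows "inf_pres L N (compose (carrier L) g f)"
  unfolding inf_pres_def
proof (intro conjI allI impI)
  show L: "complete_lattice L" and "complete_lattice N"
    using f g by (auto simp: inf_pres_def)
  fix A assume A: "A \<subseteq> carrier L"
  then have "f ` A \<subseteq> carrier M" using f by auto
  then show "compose (carrier L) g f (\<Sqinter>\<^bsub>L\<^esub>A) = \<Sqinter>\<^bsub>N\<^esub>(compose (carrier L) g f ` A)"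
    using f g A complete_lattice_inf(1)[OF L A]
    by (simp add: inf_pres_def image_compose compose_eq)
qed

lemma frame_hom_id:
  assumes "complete_lattice L"
  shows "frame_hom L L (\<lambda>x\<in>carrier L. x)"
proof -
  interpret complete_lattice L by fact
  show ?thesis
    using sup_pres_id[OF assms] lattice_axioms
    by (auto simp: frame_hom_def finite_meet_pres_def meet_pres_def)
qed

lemma frame_hom_compose:
  assumes "frame_hom L M f" "frame_hom M N g"
  shows "frame_hom L N (compose (carrier L) g f)"
proof -
  interpret L: complete_lattice L using assms(1) by (simp add: frame_hom_def sup_pres_def)
  show ?thesis
    using assms sup_pres_compose[of f L M N g]
    by (auto simp: frame_hom_def finite_meet_pres_def meet_pres_def compose_eq Pi_iff)
qed

lemma category_lc_frame_cat: "category lc_frame_cat"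
proof
  fix A B D E f g h
  show "A \<in> Ob lc_frame_cat \<Longrightarrow> Idt lc_frame_cat A \<in> Hom lc_frame_cat A A"
    by (simp add: lc_frame_cat_def frame_def frame_hom_id perfect_map_id)
  show "\<lbrakk>A \<in> Ob lc_frame_cat; B \<in> Ob lc_frame_cat; D \<in> Ob lc_frame_cat;
        f \<in> Hom lc_frame_cat A B; g \<in> Hom lc_frame_cat B D\<rbrakk>
      \<Longrightarrow> Comp lc_frame_cat A B D g f \<in> Hom lc_frame_cat A D"
    using frame_hom_compose[of A B f D g] perfect_map_compose[of A B f D g]
    by (simp add: lc_frame_cat_def frame_def frame_hom_def)
  show "\<lbrakk>A \<in> Ob lc_frame_cat; B \<in> Ob lc_frame_cat; f \<in> Hom lc_frame_cat A B\<rbrakk>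
      \<Longrightarrow> Comp lc_frame_cat A B B (Idt lc_frame_cat B) f = f"
    by (simp add: lc_frame_cat_def frame_hom_def Id_compose)
  show "\<lbrakk>A \<in> Ob lc_frame_cat; B \<in> Ob lc_frame_cat; f \<in> Hom lc_frame_cat A B\<rbrakk>
      \<Longrightarrow> Comp lc_frame_cat A A B f (Idt lc_frame_cat A) = f"
    by (simp add: lc_frame_cat_def frame_hom_def compose_Id[of f _ "carrier B"])
  show "\<lbrakk>A \<in> Ob lc_frame_cat; B \<in> Ob lc_frame_cat; D \<in> Ob lc_frame_cat; E \<in> Ob lc_frame_cat;
        f \<in> Hom lc_frame_cat A B; g \<in> Hom lc_frame_cat B D; h \<in> Hom lc_frame_cat D E\<rbrakk>
      \<Longrightarrow> Comp lc_frame_cat A D E h (Comp lc_frame_cat A B D g f) =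
          Comp lc_frame_cat A B E (Comp lc_frame_cat B D E h g) f"
    by (simp add: lc_frame_cat_def frame_hom_def compose_assoc)
qed

lemma category_cd_lattice_cat: "category cd_lattice_cat"
proof
  fix A B D E f g h
  show "A \<in> Ob cd_lattice_cat \<Longrightarrow> Idt cd_lattice_cat A \<in> Hom cd_lattice_cat A A"
    by (simp add: cd_lattice_cat_def completely_distributive_lattice_def complete_lattice_hom_def
        sup_pres_id inf_pres_id)
  show "\<lbrakk>A \<in> Ob cd_lattice_cat; B \<in> Ob cd_lattice_cat; D \<in> Ob cd_lattice_cat;
        f \<in> Hom cd_lattice_cat A B; g \<in> Hom cd_lattice_cat B D\<rbrakk>
      \<Longrightarrow> Comp cd_lattice_cat A B D g f \<in> Hom cd_lattice_cat A D"
    using sup_pres_compose[of f A B D g] inf_pres_compose[of f A B D g]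
    by (simp add: cd_lattice_cat_def complete_lattice_hom_def funcset_compose[of f _ "carrier B"])
  show "\<lbrakk>A \<in> Ob cd_lattice_cat; B \<in> Ob cd_lattice_cat; f \<in> Hom cd_lattice_cat A B\<rbrakk>
      \<Longrightarrow> Comp cd_lattice_cat A B B (Idt cd_lattice_cat B) f = f"
    by (simp add: cd_lattice_cat_def complete_lattice_hom_def Id_compose)
  show "\<lbrakk>A \<in> Ob cd_lattice_cat; B \<in> Ob cd_lattice_cat; f \<in> Hom cd_lattice_cat A B\<rbrakk>
      \<Longrightarrow> Comp cd_lattice_cat A A B f (Idt cd_lattice_cat A) = f"
    by (simp add: cd_lattice_cat_def complete_lattice_hom_def compose_Id[of f _ "carrier B"])
  show "\<lbrakk>A \<in> Ob cd_lattice_cat; B \<in> Ob cd_lattice_cat; D \<in> Ob cd_lattice_cat;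
        E \<in> Ob cd_lattice_cat;
        f \<in> Hom cd_lattice_cat A B; g \<in> Hom cd_lattice_cat B D; h \<in> Hom cd_lattice_cat D E\<rbrakk>
      \<Longrightarrow> Comp cd_lattice_cat A D E h (Comp cd_lattice_cat A B D g f) =
          Comp cd_lattice_cat A B E (Comp cd_lattice_cat B D E h g) f"
    by (simp add: cd_lattice_cat_def complete_lattice_hom_def compose_assoc)
qed

section \<open>Functoriality of the extension\<close>

text \<open>The preimage of \<open>p\<close> under the identity is \<open>p\<close>, so the two maps
  agree at every point.\<close>

lemma delta_ext_id:
  assumes "frame_extension L X e"
  shows "delta_ext L X e X e (\<lambda>x\<in>carrier L. x) = (\<lambda>u\<in>carrier X. u)"
proof -
  interpret L: frame_extension L X e by fact
  interpret I: frame_hom_extension L X e L X e "\<lambda>x\<in>carrier L. x"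
    by unfold_locales (rule frame_hom_id[OF L.L.complete_lattice_axioms])
  have "I.\<delta> u = u" if u: "u \<in> carrier X" for u
  proof (rule L.eq_by_points)
    fix p assume p: "completely_prime L p"
    note sof = completely_prime_scott_open_filter[OF p]
    have "{a \<in> carrier L. (\<lambda>x\<in>carrier L. x) a \<in> p} = p"
      using scott_open_filter_subset[OF sof] by auto
    then show "L.k p \<sqsubseteq>\<^bsub>X\<^esub> I.\<delta> u \<longleftrightarrow> L.k p \<sqsubseteq>\<^bsub>X\<^esub> u"
      using I.k_le_delta_iff[OF sof u] by simp
  qed (use u in auto)
  \<comment> \<open>Outside \<open>carrier X\<close> both sides are
    \<open>undefined\<close>.\<close>
  then show ?thesis by (auto simp: fun_eq_iff delta_ext_def sigma_ext_def)
qed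

text \<open>The preimage of \<open>q\<close> under the composite is the preimage under
  \<open>f\<close> of its preimage under \<open>g\<close>, so applying \<open>k_le_delta_iff\<close>
  once to the composite or twice in succession gives the same condition on \<open>u\<close>.\<close>

lemma delta_ext_compose:
  assumes "frame_hom_extension L X e M Y e' f" "frame_hom_extension M Y e' N Z e'' g"
  shows "delta_ext L X e Z e'' (compose (carrier L) g f) =
    compose (carrier X) (delta_ext M Y e' Z e'' g) (delta_ext L X e Y e' f)"
proof -
  interpret f: frame_hom_extension L X e M Y e' f by fact
  interpret g: frame_hom_extension M Y e' N Z e'' g by fact
  interpret gf: frame_hom_extension L X e N Z e'' "compose (carrier L) g f"
    by unfold_locales (rule frame_hom_compose[OF f.hom g.hom])
  have "gf.\<delta> u = g.\<delta> (f.\<delta> u)" if u: "u \<in> carrier X" for u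
  proof (rule g.M.eq_by_points)
    fix q assume q: "completely_prime N q"
    note sof = completely_prime_scott_open_filter[OF q]
    \<comment> \<open>Scott-openness here allows \<open>f.k_le_delta_iff\<close> to be applied at
      this preimage.\<close>
    have "{a \<in> carrier M. g a \<in> q} \<in> scott_open_filters M"
      by (rule frame_hom_scott_open_filter_vimage[OF f.M.L.frame_axioms g.M.L.frame_axioms
            g.hom sof])
    moreover have "{a \<in> carrier L. compose (carrier L) g f a \<in> q} =
        {a \<in> carrier L. f a \<in> {a \<in> carrier M. g a \<in> q}}"
      by (auto simp: compose_eq)
    ultimately show "g.M.k q \<sqsubseteq>\<^bsub>Z\<^esub> gf.\<delta> u \<longleftrightarrow> g.M.k q \<sqsubseteq>\<^bsub>Z\<^esub> g.\<delta> (f.\<delta> u)"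
      using u by (simp add: gf.k_le_delta_iff[OF sof] g.k_le_delta_iff[OF sof] f.k_le_delta_iff)
  qed (use u in auto)
  then show ?thesis by (auto simp: fun_eq_iff delta_ext_def sigma_ext_def compose_def)
qed

text \<open>The fixed choice of canonical extensions enters through the parameters \<open>X\<close>
  and \<open>e\<close>; \<open>canonical_extensions_exist\<close> supplies such a choice when
  \<open>'b\<close> is \<open>'a set set\<close>.\<close>

theorem corollary6p7:
  fixes X :: "'a gorder \<Rightarrow> 'b gorder"
    and e :: "'a gorder \<Rightarrow> 'a \<Rightarrow> 'b"
  assumes "\<And>L. frame L \<Longrightarrow> canonical_extension L (X L) (e L)"
  shows "covariant_functor lc_frame_cat cd_lattice_cat
           X (\<lambda>L M h. delta_ext L (X L) (e L) (X M) (e M) h)"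
proof -
  have ext: "frame_extension L (X L) (e L)" if "L \<in> Ob lc_frame_cat" for L
    using that assms
    by (simp add: frame_extension_def frame_extension_axioms_def lc_frame_cat_def)
  have hom: "frame_hom_extension L (X L) (e L) M (X M) (e M) f"
    if "L \<in> Ob lc_frame_cat" "M \<in> Ob lc_frame_cat" "f \<in> Hom lc_frame_cat L M" for L M f
    using that ext
    by (simp add: frame_hom_extension_def frame_hom_extension_axioms_def lc_frame_cat_def)
  show ?thesis
  proof (intro covariant_functor.intro category_lc_frame_cat category_cd_lattice_cat
      covariant_functor_axioms.intro)
    fix A B E :: "'a gorder" and f g :: "'a \<Rightarrow> 'a"
    assume A: "A \<in> Ob lc_frame_cat"
    show "X A \<in> Ob cd_lattice_cat"
      using frame_extension.completely_distributive[OF ext[OF A]] by (simp add: cd_lattice_cat_def)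
    show "delta_ext A (X A) (e A) (X A) (e A) (Idt lc_frame_cat A) = Idt cd_lattice_cat (X A)"
      using delta_ext_id[OF ext[OF A]] by (simp add: lc_frame_cat_def cd_lattice_cat_def)
    assume B: "B \<in> Ob lc_frame_cat"
    \<comment> \<open>Besides preserving joins and meets, an arrow has to be extensional, which
      comes from the restriction built into \<open>sigma_ext\<close>.\<close>
    show "delta_ext A (X A) (e A) (X B) (e B) f \<in> Hom cd_lattice_cat (X A) (X B)"
      if "f \<in> Hom lc_frame_cat A B"
      using frame_hom_extension.delta_complete_lattice_hom[OF hom[OF A B that]]
      by (simp add: cd_lattice_cat_def delta_ext_def sigma_ext_def)
    show "delta_ext A (X A) (e A) (X E) (e E) (Comp lc_frame_cat A B E g f) =
        Comp cd_lattice_cat (X A) (X B) (X E) (delta_ext B (X B) (e B) (X E) (e E) g)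
          (delta_ext A (X A) (e A) (X B) (e B) f)"
      if "E \<in> Ob lc_frame_cat" "f \<in> Hom lc_frame_cat A B" "g \<in> Hom lc_frame_cat B E"
      using delta_ext_compose[OF hom[OF A B that(2)] hom[OF B that(1,3)]]
      by (simp add: lc_frame_cat_def cd_lattice_cat_def)
  qed
qed

end
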